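(* Let $G\in\mathbb{R}^{n\times n}$ be a normalized positive semi-definite kernel matrix, let $\alpha\ge 2$ be an integer, let $\epsilon,\delta\in(0,1)$, and let $s=\lceil 8\ln(2/\delta)/\epsilon^2\rceil$. Let $\mathbf{g}_1,\dots,\mathbf{g}_s\in\mathbb{R}^n$ be i.i.d. standard Gaussian random vectors and set $$\tilde{\mathbf S}_\alpha(G)=\frac{1}{1-\alpha}\log_2\Big(\frac1s\sum_{i=1}^s \mathbf{g}_i^\top G^\alpha \mathbf{g}_i\Big).$$ Then with probability at least $1-\delta$, $$\big|\mathbf S_\alpha(G)-\tilde{\mathbf S}_\alpha(G)\big|\le\Big|\frac{1}{1-\alpha}\log_2(1-\epsilon)\Big|.$$
   Context: A normalized PSD kernel matrix is a matrix $G\in\mathbb{R}^{n\times n}$ of the form $G_{ij}=\frac1n\frac{K_{ij}}{\sqrt{K_{ii}K_{jj}}}$, where $K_{ij}=\varphi(x_i,x_j)$ for samples $x_1,\dots,x_n\in\mathcal X$ and a real-valued positive (semi-definite) infinitely divisible kernel $\varphi:\mathcal X\times\mathcal X\to\mathbb{R}$ with $\varphi(x_i,x_i)>0$. In particular $G$ is symmetric positive semi-definite with all diagonal entries $1/n$, so its trace is $1$. A positive kernel $\varphi$ is infinitely divisible if for every positive integer $p$ there is a positive kernel whose $p$-th power is $\varphi$. The matrix-based Rényi entropy of order $\alpha>0$, $\alpha\neq1$, is $\mathbf S_\alpha(G)=\frac{1}{1-\alpha}\log_2(\mathrm{tr}(G^\alpha))=\frac{1}{1-\alpha}\log_2\big(\sum_{i=1}^n\lambda_i^\alpha(G)\big)$,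 where $\lambda_i(G)$ are the eigenvalues of $G$. *)

theory Defs
  imports "HOL-Probability.Probability" "HOL-Computational_Algebra.Polynomial"
begin

definition positive_kernel :: "'x set \<Rightarrow> ('x \<Rightarrow> 'x \<Rightarrow> real) \<Rightarrow> bool" where
  "positive_kernel X \<phi> \<longleftrightarrow>
     (\<forall>x\<in>X. \<forall>y\<in>X. \<phi> x y = \<phi> y x) \<and>
     (\<forall>(m::nat) (x :: nat \<Rightarrow> 'x) (c :: nat \<Rightarrow> real). (\<forall>i<m. x i \<in> X) \<longrightarrow>
        (\<Sum>i<m. \<Sum>j<m. c i * c j * \<phi> (x i) (x j)) \<ge> 0)"

definition infinitely_divisible_kernel :: "'x set \<Rightarrow> ('x \<Rightarrow> 'x \<Rightarrow> real) \<Rightarrow> bool" where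
  "infinitely_divisible_kernel X \<phi> \<longleftrightarrow>
     positive_kernel X \<phi> \<and>
     (\<forall>p::nat. p \<ge> 1 \<longrightarrow>
        (\<exists>\<psi>. positive_kernel X \<psi> \<and> (\<forall>x\<in>X. \<forall>y\<in>X. \<phi> x y = \<psi> x y ^ p)))"

definition normalized_kernel_matrix ::
    "('x \<Rightarrow> 'x \<Rightarrow> real) \<Rightarrow> ('n::finite \<Rightarrow> 'x) \<Rightarrow> real^'n^'n" where
  "normalized_kernel_matrix \<phi> x =
     (\<chi> i j. 1 / real CARD('n) * (\<phi> (x i) (x j) / sqrt (\<phi> (x i) (x i) * \<phi> (x j) (x j))))"

definition charpoly :: "real^'n^'n \<Rightarrow> real poly" where
  "charpoly A = det (mat [:0, 1:] - map_matrix (\<lambda>a. [:a:]) A)"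

text \<open>The real eigenvalues, with algebraic multiplicity. For the symmetric matrices considered
  here these are all \<open>n\<close> eigenvalues.\<close>
definition eigenvalues :: "real^'n^'n \<Rightarrow> real multiset" where
  "eigenvalues A = proots (charpoly A)"

text \<open>Intended for symmetric positive semi-definite \<open>G\<close> and real \<open>\<alpha> > 0\<close>, \<open>\<alpha> \<noteq> 1\<close>; a zero
  eigenvalue contributes \<open>0 powr \<alpha> = 0\<close>, as in the trace of \<open>G\<close> to the power \<open>\<alpha>\<close>.\<close>
definition renyi_entropy :: "real \<Rightarrow> real^'n^'n \<Rightarrow> real" where
  "renyi_entropy \<alpha> G = 1 / (1 - \<alpha>) * log 2 (\<Sum>l\<in>#eigenvalues G. l powr \<alpha>)"

text \<open>Powers with respect to the matrix product; the multiplication of the type class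
  hierarchy on \<^typ>\<open>real^'n^'n\<close> is componentwise, so \<open>(^)\<close> is not the matrix power.\<close>
primrec matrix_power :: "real^'n^'n \<Rightarrow> nat \<Rightarrow> real^'n^'n" where
  "matrix_power A 0 = mat 1"
| "matrix_power A (Suc k) = A ** matrix_power A k"

definition renyi_entropy_estimate ::
    "nat \<Rightarrow> nat \<Rightarrow> (nat \<Rightarrow> real^'n) \<Rightarrow> real^'n^'n \<Rightarrow> real" where
  "renyi_entropy_estimate \<alpha> s v G =
     1 / (1 - real \<alpha>) * log 2 (1 / real s * (\<Sum>i=1..s. v i \<bullet> (matrix_power G \<alpha> *v v i)))"

definition std_gaussian :: "(real^'n) measure" where
  "std_gaussian = density lborel (\<lambda>x. ennreal (\<Prod>j\<in>UNIV. std_normal_density (x $ j)))"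

end

theory Submission
  imports Defs
begin

text \<open>Diagonalize \<open>G\<close> with orthonormal eigenvectors \<open>u\<^sub>k\<close> and eigenvalues \<open>d\<^sub>k \<ge> 0\<close>, and put
  \<open>T = tr G\<^sup>\<alpha>\<close> and \<open>w\<^sub>k = d\<^sub>k\<^sup>\<alpha> / T\<close>. The ratio of the trace estimate to \<open>T\<close> is the mean of the
  independent variables \<open>\<Sum>\<^sub>k w\<^sub>k (u\<^sub>k \<bullet> g\<^sub>i)\<^sup>2\<close>. The weights sum to one, so convexity of \<open>exp\<close> bounds
  their moment generating function by that of the square of a standard normal variable,
  \<open>(1 - 2 t) powr (-1/2)\<close>, without using independence of the directions.
  The entropies differ by more than the stated bound only if the ratio leaves
  \<open>[1 - \<epsilon>, 1 / (1 - \<epsilon>)]\<close>, and at both ends the Chernoff bound is at most \<open>exp (- s \<epsilon>\<^sup>2 / 4) \<le> \<delta> / 2\<close>.\<close>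

subsection \<open>Diagonalization of symmetric matrices\<close>

text \<open>Rayleigh quotient argument: \<open>x \<bullet> f x\<close> attains a maximum
  \<open>m\<close> on the compact unit sphere of \<open>S\<close>, and at a maximizer the residual
  \<open>m *\<^sub>R x - f x\<close> must vanish, since otherwise a small step along it contradicts
  maximality.\<close>

lemma selfadjoint_eigenvector_in_subspace:
  fixes f :: "'a::euclidean_space \<Rightarrow> 'a"
  assumes f: "linear f" and adj: "\<And>x y. f x \<bullet> y = x \<bullet> f y"
    and S: "subspace S" "S \<noteq> {0}" and inv: "f ` S \<subseteq> S"
  obtains x l where "x \<in> S" "norm x = 1" "f x = l *\<^sub>R x"
proof -
  interpret linear f by (fact f)
  define K where "K = sphere 0 1 \<inter> S"
  have "compact K"
    unfolding K_def using S closed_subspace by (intro compact_Int_closed) auto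
  moreover have "K \<noteq> {}"
  proof -
    obtain y where "y \<in> S" "y \<noteq> 0"
      using S subspace_0 by blast
    then have "y /\<^sub>R norm y \<in> K"
      by (simp add: K_def subspace_scale[OF S(1)])
    then show ?thesis by blast
  qed
  moreover have "continuous_on K (\<lambda>x. x \<bullet> f x)"
    using linear_continuous_on[OF f[unfolded linear_conv_bounded_linear]]
    by (intro continuous_on_inner continuous_on_id)
  ultimately obtain x where xK: "x \<in> K" and max: "\<And>y. y \<in> K \<Longrightarrow> y \<bullet> f y \<le> x \<bullet> f x"
    using continuous_attains_sup by metis
  define m where "m = x \<bullet> f x"
  have x: "x \<in> S" "norm x = 1" "x \<bullet> x = 1"
    using xK by (auto simp: K_def norm_eq_1)
  have le: "z \<bullet> f z \<le> m * (z \<bullet> z)" if "z \<in> S" for z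
  proof (cases "z = 0")
    case False
    have "z /\<^sub>R norm z \<in> K"
      using False that by (simp add: K_def subspace_scale[OF S(1)])
    from max[OF this] have "(z \<bullet> f z) / (norm z)\<^sup>2 \<le> m"
      by (simp add: m_def scale power2_eq_square divide_simps)
    then show ?thesis
      using False by (simp add: power2_norm_eq_inner divide_simps)
  qed (simp add: zero)
  define y where "y = m *\<^sub>R x - f x"
  have y: "y \<in> S"
    using inv x S(1) unfolding y_def by (intro subspace_diff subspace_scale) auto
  have "y \<bullet> y = 0"
  proof (rule ccontr)
    assume neq: "y \<bullet> y \<noteq> 0"
    then have b: "y \<bullet> y > 0"
      using inner_ge_zero[of y] by linarith
    define c where "c = m * (y \<bullet> y) - y \<bullet> f y"
    \<comment> \<open>The form \<open>m * (z \<bullet> z) - z \<bullet> f z\<close> is nonnegative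
      on \<open>S\<close> and zero at \<open>x\<close>, so along the line
      \<open>x + t *\<^sub>R y\<close> it has no constant term.\<close>
    have quad: "0 \<le> 2 * t * (y \<bullet> y) + t\<^sup>2 * c" for t
    proof -
      have "x + t *\<^sub>R y \<in> S"
        using x y S(1) by (intro subspace_add subspace_scale)
      from le[OF this]
      have "0 \<le> m * ((x + t *\<^sub>R y) \<bullet> (x + t *\<^sub>R y)) - (x + t *\<^sub>R y) \<bullet> f (x + t *\<^sub>R y)"
        by simp
      also have "\<dots> = 2 * t * (m * (x \<bullet> y) - f x \<bullet> y) + t\<^sup>2 * c"
        using adj[of x y] x(3)
        by (simp add: add scale inner_simps m_def c_def inner_commute power2_eq_square algebra_simps)
      also have "m * (x \<bullet> y) - f x \<bullet> y = y \<bullet> y"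
        by (metis inner_diff_left inner_scaleR_left y_def)
      finally show ?thesis .
    qed
    have c: "c \<ge> 0"
      using le[OF y] by (simp add: c_def)
    \<comment> \<open>A negative \<open>t\<close> small enough for the linear term to dominate; the
      denominator is \<open>c + 1\<close> because \<open>c\<close> may be zero.\<close>
    define t where "t = - (y \<bullet> y) / (c + 1)"
    have "2 * t * (y \<bullet> y) + t\<^sup>2 * c = - ((y \<bullet> y)\<^sup>2 * (c + 2)) / (c + 1)\<^sup>2"
      using c by (simp add: t_def divide_simps power2_eq_square) (simp add: algebra_simps)
    also have "\<dots> < 0"
      using b c by (simp add: divide_neg_pos)
    finally show False
      using quad[of t] by simp
  qed
  then have "f x = m *\<^sub>R x"
    by (simp add: y_def)
  with x show thesis by (intro that)
qed

text \<open>Induction on the dimension: split off a unit eigenvector \<open>x\<close> and continue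
  in its orthogonal complement \<open>T\<close> within \<open>S\<close>. Self-adjointness keeps
  \<open>T\<close> invariant, as
  \<open>x \<bullet> f y = f x \<bullet> y = l * (x \<bullet> y) = 0\<close>.\<close>

lemma selfadjoint_orthonormal_eigenbasis:
  fixes f :: "'a::euclidean_space \<Rightarrow> 'a"
  assumes f: "linear f" and adj: "\<And>x y. f x \<bullet> y = x \<bullet> f y"
    and "subspace S" "f ` S \<subseteq> S"
  shows "\<exists>B. span B = S \<and> pairwise orthogonal B \<and> (\<forall>b\<in>B. norm b = 1 \<and> (\<exists>l. f b = l *\<^sub>R b))"
  using assms(3,4)
proof (induction "dim S" arbitrary: S rule: less_induct)
  case less
  show ?case
  proof (cases "S = {0}")
    case True
    then show ?thesis by (intro exI[of _ "{}"]) auto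
  next
    case False
    obtain x l where x: "x \<in> S" "norm x = 1" "f x = l *\<^sub>R x"
      using selfadjoint_eigenvector_in_subspace[OF f adj less.prems(1) False less.prems(2)] .
    define T where "T = {y \<in> S. x \<bullet> y = 0}"
    have sub: "subspace T"
      using less.prems(1) by (auto simp: T_def subspace_def inner_add_right)
    have inv: "f ` T \<subseteq> T"
      using less.prems(2) x(3) by (auto simp: T_def adj[symmetric])
    have "x \<notin> T"
      using x(2) by (auto simp: T_def norm_eq_1)
    moreover have "T \<subseteq> S"
      by (auto simp: T_def)
    ultimately have "T \<subset> S"
      using x(1) by blast
    then have "dim T < dim S"
      using sub less.prems(1) by (intro dim_psubset) (simp add: span_eq_iff[THEN iffD2])
    from less.hyps[OF this sub inv] obtain B where B: "span B = T" "pairwise orthogonal B"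
      "\<forall>b\<in>B. norm b = 1 \<and> (\<exists>l. f b = l *\<^sub>R b)" by blast
    have BT: "B \<subseteq> T"
      using B(1) span_superset by blast
    have "span (insert x B) = S"
    proof
      show "span (insert x B) \<subseteq> S"
        using BT x(1) less.prems(1) by (intro span_minimal) (auto simp: T_def)
      show "S \<subseteq> span (insert x B)"
      proof
        fix y assume "y \<in> S"
        then have "y - (x \<bullet> y) *\<^sub>R x \<in> T"
          using x less.prems(1)
          by (auto simp: T_def inner_diff_right norm_eq_1 intro!: subspace_diff subspace_scale)
        then show "y \<in> span (insert x B)"
          unfolding span_insert B(1) by blast
      qed
    qed
    moreover have "pairwise orthogonal (insert x B)"
      using B(2) BT by (auto simp: pairwise_insert orthogonal_def T_def inner_commute)
    ultimately show ?thesis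
      using B(3) x by (intro exI[of _ "insert x B"]) blast
  qed
qed

section \<open>Orthogonal diagonalization of matrices and their powers\<close>

definition diag :: "('n \<Rightarrow> 'a::zero) \<Rightarrow> 'a^'n^'n" where
  "diag d = (\<chi> i j. if i = j then d i else 0)"

lemma matrix_mul_diag_nth: "(A ** diag d) $ i $ j = A $ i $ j * d j"
  for d :: "'n::finite \<Rightarrow> 'a::semiring_1"
  by (simp add: matrix_matrix_mult_def diag_def if_distrib cong: if_cong)

lemma diag_mul_diag: "diag c ** diag d = diag (\<lambda>i. c i * d i)"
  for c d :: "'n::finite \<Rightarrow> 'a::semiring_1"
  by (simp add: vec_eq_iff matrix_mul_diag_nth) (simp add: diag_def)

lemma diag_mul_vector_nth: "(diag d *v v) $ i = d i * v $ i"
  for d :: "'n::finite \<Rightarrow> 'a::semiring_1"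
  by (simp add: matrix_vector_mult_def diag_def if_distrib[where f="\<lambda>a. a * _"] cong: if_cong)

text \<open>An orthonormal eigenbasis has exactly \<open>CARD('n)\<close> elements, so the type
  \<open>'n\<close> itself can enumerate it; its vectors become the columns of
  \<open>P\<close>.\<close>

lemma symmetric_matrix_diagonalization:
  fixes A :: "real^'n^'n"
  assumes "transpose A = A"
  obtains P d where "orthogonal_matrix P" "A = P ** diag d ** transpose P"
proof -
  have adj: "(A *v x) \<bullet> y = x \<bullet> (A *v y)" for x y
    by (metis assms dot_lmul_matrix vector_transpose_matrix)
  obtain B where B: "span B = (UNIV :: (real^'n) set)" "pairwise orthogonal B"
    "\<And>b. b \<in> B \<Longrightarrow> norm b = 1" "\<And>b. b \<in> B \<Longrightarrow> \<exists>l. A *v b = l *\<^sub>R b"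
    using selfadjoint_orthonormal_eigenbasis[OF matrix_vector_mul_linear[of A] adj, of UNIV] by auto
  have "0 \<notin> B"
    using B(3) by force
  then have "independent B"
    using B(2) by (rule pairwise_orthogonal_independent[rotated])
  then have "finite B" "card B = CARD('n)"
    using dim_span_eq_card_independent[of B] B(1) by (auto simp: independent_imp_finite)
  then obtain h where h: "bij_betw h (UNIV :: 'n set) B"
    using finite_same_card_bij[of "UNIV :: 'n set" B] by auto
  then have hB: "h i \<in> B" for i
    by (auto simp: bij_betw_def)
  have "\<exists>d. \<forall>i. A *v h i = d i *\<^sub>R h i"
    by (intro choice allI B(4) hB)
  then obtain d where d: "\<And>i. A *v h i = d i *\<^sub>R h i"
    by blast
  define P :: "real^'n^'n" where "P = (\<chi> i j. h j $ i)"
  have "column j P = h j" for j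
    by (simp add: P_def column_def)
  moreover have "h i \<noteq> h j" if "i \<noteq> j" for i j
    using h that by (auto simp: bij_betw_def dest: injD)
  ultimately have P: "orthogonal_matrix P"
    using B(2,3) hB by (auto simp: orthogonal_matrix_orthonormal_columns pairwise_def)
  have "(A ** P) $ i $ j = (P ** diag d) $ i $ j" for i j
  proof -
    have "(A ** P) $ i $ j = (A *v h j) $ i"
      by (simp add: P_def matrix_matrix_mult_def matrix_vector_mult_def)
    then show ?thesis
      by (simp add: d matrix_mul_diag_nth P_def)
  qed
  then have "A ** P = P ** diag d"
    by (simp add: vec_eq_iff)
  then have "P ** diag d ** transpose P = A ** (P ** transpose P)"
    by (simp add: matrix_mul_assoc)
  also have "\<dots> = A"
    using P by (simp add: orthogonal_matrix_def)
  finally show thesis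
    by (rule that[OF P sym])
qed

lemma matrix_power_diagonalized:
  fixes P :: "real^'n^'n"
  assumes "orthogonal_matrix P"
  shows "matrix_power (P ** diag d ** transpose P) k = P ** diag (\<lambda>i. d i ^ k) ** transpose P"
proof (induction k)
  case 0
  have "diag (\<lambda>i::'n. 1::real) = mat 1"
    by (simp add: diag_def mat_def)
  then show ?case
    using assms by (simp add: orthogonal_matrix_def)
next
  case (Suc k)
  have "(P ** diag d ** transpose P) ** (P ** diag (\<lambda>i. d i ^ k) ** transpose P)
      = P ** diag d ** (transpose P ** P) ** diag (\<lambda>i. d i ^ k) ** transpose P"
    by (simp only: matrix_mul_assoc)
  also have "\<dots> = P ** (diag d ** diag (\<lambda>i. d i ^ k)) ** transpose P"
    using assms by (simp add: orthogonal_matrix_def matrix_mul_assoc)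
  finally show ?case
    using Suc by (simp add: diag_mul_diag)
qed

text \<open>In eigenvector coordinates a Gaussian vector enters the estimator only through its
  projections onto the unit columns of \<open>P\<close>.\<close>

lemma quadratic_form_diagonalized:
  fixes P :: "real^'n^'n"
  shows "v \<bullet> ((P ** diag d ** transpose P) *v v) = (\<Sum>k\<in>UNIV. d k * (column k P \<bullet> v)\<^sup>2)"
proof -
  have tP: "(transpose P *v v) $ k = column k P \<bullet> v" for k
    by (simp add: matrix_vector_mult_def transpose_def column_def inner_vec_def)
  have "v \<bullet> ((P ** diag d ** transpose P) *v v) = (transpose P *v v) \<bullet> (diag d *v (transpose P *v v))"
    by (simp add: dot_lmul_matrix flip: matrix_vector_mul_assoc)
  also have "\<dots> = (\<Sum>k\<in>UNIV. d k * ((transpose P *v v) $ k)\<^sup>2)"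
    by (simp add: inner_vec_def[of _ "diag d *v _"] diag_mul_vector_nth power2_eq_square
        mult.left_commute)
  finally show ?thesis
    by (simp only: tP)
qed

section \<open>Characteristic polynomial and eigenvalues\<close>

lemma map_matrix_mul:
  fixes A B :: "'a::comm_semiring_1^'n^'n"
  shows "map_matrix (\<lambda>a. [:a:]) (A ** B) = map_matrix (\<lambda>a. [:a:]) A ** map_matrix (\<lambda>a. [:a:]) B"
proof -
  have "[:sum f UNIV:] = (\<Sum>i\<in>UNIV. [:f i:])" for f :: "'n \<Rightarrow> 'a"
    by (simp add: poly_eq_iff coeff_sum coeff_pCons split: nat.splits)
  then show ?thesis
    by (simp add: vec_eq_iff map_matrix_def matrix_matrix_mult_def mult.commute)
qed

text \<open>Conjugation by \<open>P\<close> is carried over to polynomial matrices, where the lifts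
  of \<open>P\<close> and \<open>transpose P\<close> are still inverse to each other. The scalar
  matrix \<open>?X\<close> commutes with everything, so the whole characteristic matrix is
  conjugated and the outer determinants cancel.\<close>

lemma charpoly_diagonalized:
  fixes P :: "real^'n^'n"
  assumes P: "orthogonal_matrix P"
  shows "charpoly (P ** diag d ** transpose P) = (\<Prod>i\<in>UNIV. [:- d i, 1:])"
proof -
  let ?c = "map_matrix (\<lambda>a::real. [:a:]) :: real^'n^'n \<Rightarrow> real poly^'n^'n"
  let ?X = "mat [:0, 1:] :: real poly^'n^'n"
  have one: "?c (mat 1) = mat 1"
    by (simp add: vec_eq_iff map_matrix_def mat_def)
  have inv: "?c P ** ?c (transpose P) = mat 1"
    using P by (simp add: orthogonal_matrix_def one flip: map_matrix_mul)
  have X: "B ** ?X = ?X ** B" for B :: "real poly^'n^'n"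
    by (simp add: vec_eq_iff matrix_matrix_mult_def mat_def if_distrib if_distribR
        mult.commute cong: if_cong)
  have diff: "C ** (A - B) = C ** A - C ** B" "(A - B) ** C = A ** C - B ** C"
    for A B C :: "real poly^'n^'n"
    by (simp_all add: vec_eq_iff matrix_matrix_mult_def sum_subtractf algebra_simps)
  have "?X - ?c (P ** diag d ** transpose P) = ?c P ** (?X - ?c (diag d)) ** ?c (transpose P)"
  proof -
    have "?X = ?c P ** ?X ** ?c (transpose P)"
      by (simp add: X inv flip: matrix_mul_assoc)
    then show ?thesis
      by (simp add: map_matrix_mul diff)
  qed
  then have "charpoly (P ** diag d ** transpose P)
      = det (?c P ** ?c (transpose P)) * det (?X - ?c (diag d))"
    by (simp add: charpoly_def det_mul)
  also have "\<dots> = det (?X - ?c (diag d))"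
    by (simp add: inv)
  also have "\<dots> = (\<Prod>i\<in>UNIV. [:- d i, 1:])"
    by (subst det_diagonal) (auto simp: mat_def diag_def map_matrix_def)
  finally show ?thesis .
qed

lemma eigenvalues_diagonalized:
  fixes P :: "real^'n^'n"
  assumes "orthogonal_matrix P"
  shows "eigenvalues (P ** diag d ** transpose P) = image_mset d (mset_set UNIV)"
proof -
  have "proots (\<Prod>i\<in>UNIV. [:- d i, 1:]) = (\<Sum>i\<in>UNIV. {#d i#})"
    by (subst proots_prod) auto
  also have "\<dots> = image_mset d (mset_set UNIV)"
    by (simp add: sum_unfold_sum_mset)
  finally show ?thesis
    using assms by (simp add: eigenvalues_def charpoly_diagonalized)
qed

section \<open>Normalized kernel matrices\<close>

text \<open>The normalization is absorbed into the coefficients \<open>c i\<close>; up to the factor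
  \<open>?n\<close> what remains is the quadratic form of the kernel.\<close>

lemma normalized_kernel_matrix_psd:
  fixes x :: "'n::finite \<Rightarrow> 'x"
  assumes "positive_kernel X \<phi>" "\<And>i. x i \<in> X"
  shows "0 \<le> v \<bullet> (normalized_kernel_matrix \<phi> x *v v)"
proof -
  let ?n = "CARD('n)"
  \<comment> \<open>\<open>positive_kernel\<close> speaks of points indexed by an initial segment of
    the naturals, so the index type is enumerated.\<close>
  obtain h where h: "bij_betw h {..<?n} (UNIV :: 'n set)"
    using finite_same_card_bij[of "{..<?n}" "UNIV :: 'n set"] by auto
  define c where "c i = v $ i / sqrt (\<phi> (x i) (x i))" for i
  have "0 \<le> (\<Sum>i<?n. \<Sum>j<?n. c (h i) * c (h j) * \<phi> (x (h i)) (x (h j)))"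
    using assms unfolding positive_kernel_def
    by (elim conjE allE[of _ ?n] allE[of _ "\<lambda>i. x (h i)"] allE[of _ "\<lambda>i. c (h i)"]) auto
  also have "\<dots> = (\<Sum>i\<in>UNIV. \<Sum>j\<in>UNIV. c i * c j * \<phi> (x i) (x j))"
    by (simp add: sum.reindex_bij_betw[OF h, of "\<lambda>j. c _ * c j * \<phi> _ (x j)"]
        sum.reindex_bij_betw[OF h, of "\<lambda>i. \<Sum>j\<in>UNIV. c i * c j * \<phi> (x i) (x j)"])
  also have "\<dots> = ?n * (v \<bullet> (normalized_kernel_matrix \<phi> x *v v))"
    by (simp add: normalized_kernel_matrix_def inner_vec_def matrix_vector_mult_def c_def
        sum_distrib_left real_sqrt_mult mult_ac)
  finally show ?thesis
    by (simp add: zero_le_mult_iff)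
qed

lemma normalized_kernel_matrix_symmetric:
  assumes "positive_kernel X \<phi>" "\<And>i. x i \<in> X"
  shows "transpose (normalized_kernel_matrix \<phi> x) = normalized_kernel_matrix \<phi> x"
  using assms by (simp add: positive_kernel_def vec_eq_iff transpose_def
      normalized_kernel_matrix_def mult.commute)

text \<open>The quadratic form evaluated at the \<open>k\<close>-th column of \<open>P\<close> is
  \<open>d k\<close>.\<close>

lemma psd_diagonalized_nonneg:
  fixes P :: "real^'n^'n"
  assumes P: "orthogonal_matrix P" and psd: "\<And>v. 0 \<le> v \<bullet> ((P ** diag d ** transpose P) *v v)"
  shows "0 \<le> d k"
proof -
  have col: "column i P \<bullet> column k P = (if i = k then 1 else 0)" for i
    using P by (auto simp: orthogonal_matrix_orthonormal_columns orthogonal_def norm_eq_1)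
  have "d i * (column i P \<bullet> column k P)\<^sup>2 = (if i = k then d k else 0)" for i
    by (simp add: col)
  then have "column k P \<bullet> ((P ** diag d ** transpose P) *v column k P) = d k"
    by (simp add: quadratic_form_diagonalized)
  then show ?thesis
    using psd by metis
qed

subsection \<open>Gaussian quadratic forms\<close>

text \<open>The product rule for \<open>lborel\<close> runs over \<open>Basis\<close>, which is
  reindexed by the injection \<open>axis\<close>.\<close>

lemma nn_integral_lborel_vec_prod:
  fixes f :: "'n::finite \<Rightarrow> real \<Rightarrow> ennreal"
  assumes [measurable]: "\<And>i. f i \<in> borel_measurable borel"
  shows "(\<integral>\<^sup>+x. (\<Prod>i\<in>UNIV. f i (x $ i)) \<partial>(lborel :: (real^'n) measure))
    = (\<Prod>i\<in>UNIV. \<integral>\<^sup>+x. f i x \<partial>lborel)"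
proof -
  let ?e = "\<lambda>i::'n. axis i (1::real)"
  have B: "Basis = range ?e"
    by (auto simp: Basis_vec_def)
  have inj: "inj ?e"
    by (auto intro!: injI simp: axis_eq_axis)
  have reindex: "(\<Prod>b\<in>Basis. h b) = (\<Prod>i\<in>UNIV. h (?e i))" for h :: "real^'n \<Rightarrow> 'b::comm_monoid_mult"
    by (simp add: B prod.reindex[OF inj])
  have "(\<integral>\<^sup>+x. (\<Prod>b\<in>Basis. f (inv ?e b) (x \<bullet> b)) \<partial>(lborel :: (real^'n) measure))
      = (\<Prod>b\<in>Basis. \<integral>\<^sup>+x. f (inv ?e b) x \<partial>lborel)"
    by (rule nn_integral_lborel_prod) auto
  then show ?thesis
    by (simp add: reindex inv_f_f[OF inj] inner_axis)
qed

lemma borel_measurable_vec_nth [measurable]: "(\<lambda>x::real^'n. x $ i) \<in> borel_measurable borel"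
  by (intro borel_measurable_continuous_onI continuous_intros)

lemma nn_integral_std_gaussian_prod:
  fixes f :: "'n::finite \<Rightarrow> real \<Rightarrow> ennreal"
  assumes [measurable]: "\<And>i. f i \<in> borel_measurable borel"
  shows "(\<integral>\<^sup>+x. (\<Prod>i\<in>UNIV. f i (x $ i)) \<partial>(std_gaussian :: (real^'n) measure))
    = (\<Prod>i\<in>UNIV. \<integral>\<^sup>+x. f i x \<partial>std_normal_distribution)"
proof -
  have "(\<integral>\<^sup>+x. (\<Prod>i\<in>UNIV. f i (x $ i)) \<partial>(std_gaussian :: (real^'n) measure))
      = (\<integral>\<^sup>+x. (\<Prod>i\<in>UNIV. std_normal_density (x $ i) * f i (x $ i)) \<partial>(lborel :: (real^'n) measure))"
    unfolding std_gaussian_def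
    by (subst nn_integral_density) (auto simp: prod.distrib prod_ennreal)
  also have "\<dots> = (\<Prod>i\<in>UNIV. \<integral>\<^sup>+x. std_normal_density x * f i x \<partial>lborel)"
    by (rule nn_integral_lborel_vec_prod) auto
  also have "\<dots> = (\<Prod>i\<in>UNIV. \<integral>\<^sup>+x. f i x \<partial>std_normal_distribution)"
    by (simp add: nn_integral_density)
  finally show ?thesis .
qed

lemma prob_space_std_gaussian: "prob_space (std_gaussian :: (real^'n) measure)"
proof
  interpret N: prob_space std_normal_distribution
    by (rule prob_space_normal_density) simp
  show "emeasure (std_gaussian :: (real^'n) measure) (space std_gaussian) = 1"
    using nn_integral_std_gaussian_prod[of "\<lambda>(_::'n) _. 1"] N.emeasure_space_1
    by simp
qed

lemma sets_std_gaussian [measurable_cong, simp]: "sets std_gaussian = sets borel"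
  by (simp add: std_gaussian_def)

lemma emeasure_std_gaussian_Pi:
  fixes A :: "'n::finite \<Rightarrow> real set"
  assumes [measurable]: "\<And>i. A i \<in> sets borel"
  shows "emeasure std_gaussian {x. \<forall>i. x $ i \<in> A i} = (\<Prod>i\<in>UNIV. emeasure std_normal_distribution (A i))"
proof -
  have [measurable]: "{x :: real^'n. \<forall>i. x $ i \<in> A i} \<in> sets borel"
    by measurable
  have "emeasure std_gaussian {x. \<forall>i. x $ i \<in> A i}
      = (\<integral>\<^sup>+x. indicator {x. \<forall>i. x $ i \<in> A i} x \<partial>(std_gaussian :: (real^'n) measure))"
    by simp
  also have "\<dots> = (\<integral>\<^sup>+x. (\<Prod>i\<in>UNIV. indicator (A i) (x $ i)) \<partial>(std_gaussian :: (real^'n) measure))"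
    by (intro nn_integral_cong) (auto simp: indicator_def intro!: prod_zero[symmetric])
  also have "\<dots> = (\<Prod>i\<in>UNIV. \<integral>\<^sup>+x. indicator (A i) x \<partial>std_normal_distribution)"
    by (rule nn_integral_std_gaussian_prod) auto
  finally show ?thesis
    by simp
qed

lemma std_gaussian_component:
  "distr std_gaussian borel (\<lambda>x::real^'n. x $ k) = std_normal_distribution"
proof (rule measure_eqI)
  fix A assume "A \<in> sets (distr std_gaussian borel (\<lambda>x::real^'n. x $ k))"
  then have [measurable]: "A \<in> sets borel" by simp
  interpret N: prob_space std_normal_distribution
    by (rule prob_space_normal_density) simp
  \<comment> \<open>The marginal event is a box whose other sides are \<open>UNIV\<close>, each
    contributing a factor 1.\<close>
  have "emeasure (distr std_gaussian borel (\<lambda>x::real^'n. x $ k)) A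
      = emeasure std_gaussian {x::real^'n. \<forall>i. x $ i \<in> (if i = k then A else UNIV)}"
    by (subst emeasure_distr) (auto simp: std_gaussian_def intro!: arg_cong2[where f=emeasure])
  also have "\<dots> = (\<Prod>i\<in>(UNIV::'n set). if i = k then emeasure std_normal_distribution A else 1)"
    using N.emeasure_space_1
    by (subst emeasure_std_gaussian_Pi)
      (auto simp: if_distrib[where f="emeasure std_normal_distribution"] cong: if_cong)
  finally show "emeasure (distr std_gaussian borel (\<lambda>x::real^'n. x $ k)) A
      = emeasure std_normal_distribution A"
    by simp
qed simp

lemma indep_vars_std_gaussian_components:
  "prob_space.indep_vars (std_gaussian :: (real^'n) measure) (\<lambda>_. borel) (\<lambda>i x. x $ i) UNIV"
proof -
  interpret prob_space "std_gaussian :: (real^'n) measure"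
    by (rule prob_space_std_gaussian)
  interpret N: prob_space std_normal_distribution
    by (rule prob_space_normal_density) simp
  have sp: "space (std_gaussian :: (real^'n) measure) = UNIV"
    by (simp add: std_gaussian_def)
  have m: "random_variable borel (\<lambda>x::real^'n. x $ i)" for i
    by measurable
  have em: "emeasure std_gaussian {x::real^'n. x $ i \<in> A}
      = emeasure std_normal_distribution A" if "A \<in> sets borel" for i A
    using that emeasure_distr[OF m that, of i]
    by (simp add: std_gaussian_component sp vimage_def)
  show ?thesis
    unfolding indep_vars_def2
  \<comment> \<open>Each family contains the whole space, so it suffices to treat intersections over
    all coordinates, and these are boxes.\<close>
  proof (intro conjI ballI m, subst indep_sets_finite)
    show "\<forall>A\<in>Pi UNIV (\<lambda>i. {(\<lambda>x::real^'n. x $ i) -` A \<inter> space std_gaussian |A. A \<in> sets borel}).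
      prob (\<Inter>j\<in>UNIV. A j) = (\<Prod>j\<in>UNIV. prob (A j))"
    proof
      fix A assume "A \<in> Pi UNIV (\<lambda>i. {(\<lambda>x::real^'n. x $ i) -` A \<inter> space std_gaussian |A. A \<in> sets borel})"
      then have "\<forall>i. \<exists>C. A i = (\<lambda>x. x $ i) -` C \<and> C \<in> sets borel"
        by (auto simp: sp Pi_iff)
      then obtain C where C: "\<And>i. C i \<in> sets borel" "\<And>i. A i = {x. x $ i \<in> C i}"
        by (metis vimage_def)
      have "emeasure std_gaussian (\<Inter>j. A j) = (\<Prod>j\<in>UNIV. emeasure std_gaussian (A j))"
        using emeasure_std_gaussian_Pi[of C] C by (simp add: em INTER_eq)
      then show "prob (\<Inter>j. A j) = (\<Prod>j\<in>UNIV. prob (A j))"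
        by (simp add: emeasure_eq_measure prod_ennreal prod_nonneg)
    qed
  qed (auto simp: sp intro: exI[of _ UNIV] measurable_sets_borel[OF borel_measurable_vec_nth])
qed

text \<open>\<open>u \<bullet> x\<close> is a sum of independent centred normals with standard
  deviations \<open>\<bar>u $ i\<bar>\<close>, whose variances add up to the squared norm of
  \<open>u\<close>.\<close>

lemma std_gaussian_unit_direction:
  fixes u :: "real^'n"
  assumes "norm u = 1"
  shows "distr std_gaussian borel (\<lambda>x. u \<bullet> x) = std_normal_distribution"
proof -
  interpret prob_space "std_gaussian :: (real^'n) measure"
    by (rule prob_space_std_gaussian)
  \<comment> \<open>Zero coordinates would give degenerate normals, while
    \<open>sum_indep_normal\<close> asks for positive standard deviations.\<close>
  define I where "I = {i. u $ i \<noteq> 0}"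
  have norm_I: "(\<Sum>i\<in>I. (u $ i)\<^sup>2) = 1"
  proof -
    have "(\<Sum>i\<in>I. (u $ i)\<^sup>2) = (\<Sum>i\<in>UNIV. (u $ i)\<^sup>2)"
      by (intro sum.mono_neutral_left) (auto simp: I_def)
    also have "\<dots> = u \<bullet> u"
      by (simp add: inner_vec_def power2_eq_square)
    finally show ?thesis
      using assms by (simp add: norm_eq_1)
  qed
  have comp: "distributed std_gaussian lborel (\<lambda>x::real^'n. x $ i) std_normal_density" for i
    using std_gaussian_component[of i] by (auto simp: distributed_def cong: distr_cong)
  have "distributed std_gaussian lborel (\<lambda>x. \<Sum>i\<in>I. u $ i * x $ i)
      (normal_density (\<Sum>i\<in>I. 0) (sqrt (\<Sum>i\<in>I. \<bar>u $ i\<bar>\<^sup>2)))"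
  proof (rule sum_indep_normal)
    show "I \<noteq> {}"
      using norm_I by auto
    show "indep_vars (\<lambda>_. borel) (\<lambda>i x. u $ i * x $ i) I"
      using indep_vars_compose2[OF indep_vars_subset[OF indep_vars_std_gaussian_components subset_UNIV],
        where Y="\<lambda>i x. u $ i * x" and N="\<lambda>_. borel"]
      by simp
    show "distributed std_gaussian lborel (\<lambda>x. u $ i * x $ i) (normal_density 0 \<bar>u $ i\<bar>)"
      if "i \<in> I" for i
      using normal_density_affine[OF comp[of i], of "u $ i" 0] that by (simp add: I_def)
  qed (auto simp: I_def)
  then have "distributed std_gaussian lborel (\<lambda>x. \<Sum>i\<in>I. u $ i * x $ i) std_normal_density"
    by (simp add: norm_I)
  moreover have "(\<Sum>i\<in>I. u $ i * x $ i) = u \<bullet> x" for x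
    unfolding inner_vec_def inner_real_def by (intro sum.mono_neutral_left) (auto simp: I_def)
  ultimately show ?thesis
    by (simp add: distributed_def cong: distr_cong)
qed

section \<open>Exponential moments and the Chernoff bound\<close>

text \<open>The factor \<open>exp (t * z\<^sup>2)\<close> turns the standard normal density into
  \<open>\<sigma>\<close> times a centred normal density of variance \<open>1 / (1 - 2 * t)\<close>,
  which integrates to one.\<close>

lemma nn_integral_exp_square_std_normal:
  assumes "t < 1/2"
  shows "(\<integral>\<^sup>+z. exp (t * z\<^sup>2) \<partial>std_normal_distribution) = ennreal (1 / sqrt (1 - 2 * t))"
proof -
  define \<sigma> where "\<sigma> = 1 / sqrt (1 - 2 * t)"
  have \<sigma>: "\<sigma> > 0" and \<sigma>2: "\<sigma>\<^sup>2 = 1 / (1 - 2 * t)"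
    using assms by (auto simp: \<sigma>_def power_divide)
  have eq: "std_normal_density z * exp (t * z\<^sup>2) = \<sigma> * normal_density 0 \<sigma> z" for z
  proof -
    have "- z\<^sup>2 / 2 + t * z\<^sup>2 = - z\<^sup>2 / (2 * \<sigma>\<^sup>2)"
      using assms by (simp add: \<sigma>2 field_simps)
    then have "exp (- z\<^sup>2 / 2) * exp (t * z\<^sup>2) = exp (- z\<^sup>2 / (2 * \<sigma>\<^sup>2))"
      by (simp flip: exp_add)
    then show ?thesis
      using \<sigma> by (simp add: normal_density_def real_sqrt_mult)
  qed
  have "(\<integral>\<^sup>+z. exp (t * z\<^sup>2) \<partial>std_normal_distribution) = (\<integral>\<^sup>+z. \<sigma> * normal_density 0 \<sigma> z \<partial>lborel)"
    by (simp add: nn_integral_density flip: ennreal_mult' eq)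
  also have "\<dots> = \<sigma> * emeasure (density lborel (normal_density 0 \<sigma>)) UNIV"
    using \<sigma> by (simp add: ennreal_mult nn_integral_cmult emeasure_density)
  also have "\<dots> = \<sigma>"
    using prob_space.emeasure_space_1[OF prob_space_normal_density[OF \<sigma>, of 0]] by simp
  finally show ?thesis
    by (simp add: \<sigma>_def)
qed

text \<open>Jensen's inequality pulls the convex combination out of \<open>exp\<close>; afterwards
  each term involves a single projection, which is standard normal, so all terms have the same
  integral.\<close>

lemma nn_integral_exp_quadratic_form_le:
  fixes u :: "'k \<Rightarrow> real^'n"
  assumes K: "finite K" and w: "\<And>k. k \<in> K \<Longrightarrow> 0 \<le> w k" "sum w K = 1"
    and u: "\<And>k. k \<in> K \<Longrightarrow> norm (u k) = 1" and t: "t < 1/2"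
  shows "(\<integral>\<^sup>+x. exp (t * (\<Sum>k\<in>K. w k * (u k \<bullet> x)\<^sup>2)) \<partial>std_gaussian) \<le> ennreal (1 / sqrt (1 - 2 * t))"
proof -
  have "K \<noteq> {}"
    using w(2) by auto
  then have "exp (t * (\<Sum>k\<in>K. w k * (u k \<bullet> x)\<^sup>2)) \<le> (\<Sum>k\<in>K. w k * exp (t * (u k \<bullet> x)\<^sup>2))" for x
    using convex_on_sum[OF K _ exp_convex w(2,1), of "\<lambda>k. t * (u k \<bullet> x)\<^sup>2"]
    by (simp add: sum_distrib_left mult.left_commute)
  then have "(\<integral>\<^sup>+x. exp (t * (\<Sum>k\<in>K. w k * (u k \<bullet> x)\<^sup>2)) \<partial>std_gaussian)
      \<le> (\<integral>\<^sup>+x. (\<Sum>k\<in>K. ennreal (w k) * ennreal (exp (t * (u k \<bullet> x)\<^sup>2))) \<partial>std_gaussian)"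
    using w(1) by (intro nn_integral_mono) (simp add: sum_ennreal ennreal_leI flip: ennreal_mult')
  also have "\<dots> = (\<Sum>k\<in>K. ennreal (w k) * (\<integral>\<^sup>+x. ennreal (exp (t * (u k \<bullet> x)\<^sup>2)) \<partial>std_gaussian))"
    by (simp add: nn_integral_sum nn_integral_cmult)
  also have "\<dots> = (\<Sum>k\<in>K. ennreal (w k) * ennreal (1 / sqrt (1 - 2 * t)))"
  proof (intro sum.cong refl arg_cong2[where f="(*)"])
    fix k assume "k \<in> K"
    have "(\<integral>\<^sup>+x. ennreal (exp (t * (u k \<bullet> x)\<^sup>2)) \<partial>std_gaussian)
        = (\<integral>\<^sup>+z. ennreal (exp (t * z\<^sup>2)) \<partial>distr std_gaussian borel (\<lambda>x. u k \<bullet> x))"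
      by (subst nn_integral_distr) auto
    then show "(\<integral>\<^sup>+x. ennreal (exp (t * (u k \<bullet> x)\<^sup>2)) \<partial>std_gaussian) = ennreal (1 / sqrt (1 - 2 * t))"
      using \<open>k \<in> K\<close> u t by (simp add: std_gaussian_unit_direction nn_integral_exp_square_std_normal)
  qed
  also have "\<dots> = ennreal (1 / sqrt (1 - 2 * t))"
    using w by (simp add: sum_ennreal flip: sum_distrib_right)
  finally show ?thesis .
qed

text \<open>The factor \<open>1 - 1 / r\<close> has the sign of \<open>r - 1\<close>, so this is the upper tail for \<open>r > 1\<close> and the
  lower tail for \<open>r < 1\<close>. Half of it is the optimal parameter \<open>t\<close> in the exponential Markov inequality.\<close>

lemma (in prob_space) gaussian_quadratic_form_chernoff:
  fixes u :: "'k \<Rightarrow> real^'n" and g :: "'i \<Rightarrow> 'a \<Rightarrow> real^'n" and r :: real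
  assumes K: "finite K" and w: "\<And>k. k \<in> K \<Longrightarrow> 0 \<le> w k" "sum w K = 1"
    and u: "\<And>k. k \<in> K \<Longrightarrow> norm (u k) = 1"
    and I: "finite I" and indep: "indep_vars (\<lambda>_. borel) g I"
    and gauss: "\<And>i. i \<in> I \<Longrightarrow> distr M borel (g i) = std_gaussian"
    and r: "r > 0"
  shows "prob {\<omega> \<in> space M. 0 \<le> (1 - 1 / r) * ((\<Sum>i\<in>I. \<Sum>k\<in>K. w k * (u k \<bullet> g i \<omega>)\<^sup>2) - card I * r)}
    \<le> exp (- (card I / 2) * (r - 1 - ln r))"
proof -
  define q where "q x = (\<Sum>k\<in>K. w k * (u k \<bullet> x)\<^sup>2)" for x
  define t where "t = (1 - 1 / r) / 2"
  have [measurable]: "g i \<in> borel_measurable M" if "i \<in> I" for i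
    using indep that by (simp add: indep_vars_def)
  have [measurable]: "q \<in> borel_measurable borel"
    unfolding q_def by measurable
  have t: "t < 1/2" and t2: "1 - 2 * t = 1 / r" and tr: "t * r = (r - 1) / 2"
    using r by (auto simp: t_def field_simps)
  have "(\<integral>\<^sup>+\<omega>. (\<Prod>i\<in>I. ennreal (exp (t * q (g i \<omega>)))) \<partial>M)
      = (\<Prod>i\<in>I. \<integral>\<^sup>+\<omega>. ennreal (exp (t * q (g i \<omega>))) \<partial>M)"
    by (intro indep_vars_nn_integral I
        indep_vars_compose2[OF indep, where Y="\<lambda>_ x. ennreal (exp (t * q x))"]) auto
  also have "\<dots> \<le> (\<Prod>i\<in>I. ennreal (1 / sqrt (1 - 2 * t)))"
  proof (intro prod_mono_ennreal)
    fix i assume i: "i \<in> I"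
    have "(\<integral>\<^sup>+\<omega>. ennreal (exp (t * q (g i \<omega>))) \<partial>M) = (\<integral>\<^sup>+x. ennreal (exp (t * q x)) \<partial>distr M borel (g i))"
      using i by (subst nn_integral_distr) auto
    also have "\<dots> \<le> ennreal (1 / sqrt (1 - 2 * t))"
      unfolding gauss[OF i] q_def by (rule nn_integral_exp_quadratic_form_le[OF K w u t])
    finally show "(\<integral>\<^sup>+\<omega>. ennreal (exp (t * q (g i \<omega>))) \<partial>M) \<le> ennreal (1 / sqrt (1 - 2 * t))" .
  qed
  \<comment> \<open>With this \<open>t\<close> the moment bound is the square root of
    \<open>r\<close>, the source of \<open>ln r\<close> in the rate.\<close>
  also have "1 / sqrt (1 - 2 * t) = exp (ln r / 2)"
    using r by (simp add: t2 real_sqrt_divide flip: ln_sqrt)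
  also have "(\<Prod>i\<in>I. ennreal (exp (ln r / 2))) = ennreal (exp (card I * (ln r / 2)))"
    by (simp only: prod_constant ennreal_power exp_ge_zero exp_of_nat_mult)
  finally have mgf: "(\<integral>\<^sup>+\<omega>. (\<Prod>i\<in>I. ennreal (exp (t * q (g i \<omega>)))) \<partial>M)
      \<le> ennreal (exp (card I * (ln r / 2)))" .
  \<comment> \<open>Exponentiating gives the shape required by Markov's inequality. The sign of
    \<open>t\<close> is built into the event, so both tails are treated at once.\<close>
  have "emeasure M {\<omega> \<in> space M. 0 \<le> (1 - 1 / r) * ((\<Sum>i\<in>I. q (g i \<omega>)) - card I * r)}
      \<le> emeasure M {\<omega> \<in> space M. 1 \<le> ennreal (exp (- (t * r * card I))) * (\<Prod>i\<in>I. ennreal (exp (t * q (g i \<omega>))))}"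
  proof (intro emeasure_mono subsetI CollectI conjI; (elim CollectE conjE)?)
    fix \<omega> assume "0 \<le> (1 - 1 / r) * ((\<Sum>i\<in>I. q (g i \<omega>)) - card I * r)"
    then have "1 \<le> exp (t * ((\<Sum>i\<in>I. q (g i \<omega>)) - card I * r))"
      by (simp add: t_def)
    also have "\<dots> = exp (- (t * r * card I)) * (\<Prod>i\<in>I. exp (t * q (g i \<omega>)))"
      using I by (simp add: algebra_simps sum_distrib_left flip: exp_sum exp_add)
    finally show "1 \<le> ennreal (exp (- (t * r * card I))) * (\<Prod>i\<in>I. ennreal (exp (t * q (g i \<omega>))))"
      by (simp add: prod_ennreal prod_nonneg flip: ennreal_mult')
  qed (use I in auto)
  also have "\<dots> \<le> ennreal (exp (- (t * r * card I)))
      * (\<integral>\<^sup>+\<omega>. (\<Prod>i\<in>I. ennreal (exp (t * q (g i \<omega>)))) * indicator (space M) \<omega> \<partial>M)"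
    by (rule nn_integral_Markov_inequality) (use I in auto)
  also have "(\<integral>\<^sup>+\<omega>. (\<Prod>i\<in>I. ennreal (exp (t * q (g i \<omega>)))) * indicator (space M) \<omega> \<partial>M)
      = (\<integral>\<^sup>+\<omega>. (\<Prod>i\<in>I. ennreal (exp (t * q (g i \<omega>)))) \<partial>M)"
    by (intro nn_integral_cong) auto
  also have "ennreal (exp (- (t * r * card I))) * \<dots>
      \<le> ennreal (exp (- (t * r * card I))) * ennreal (exp (card I * (ln r / 2)))"
    by (intro mult_left_mono mgf) auto
  also have "\<dots> = ennreal (exp (- (t * r * card I) + card I * (ln r / 2)))"
    by (simp only: exp_add ennreal_mult' exp_ge_zero)
  also have "- (t * r * card I) + card I * (ln r / 2) = - (card I / 2) * (r - 1 - ln r)"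
    unfolding tr by (simp add: field_simps)
  finally show ?thesis
    by (simp add: q_def emeasure_eq_measure)
qed

section \<open>Quadratic lower bounds for the rate \<open>r - 1 - ln r\<close>\<close>

text \<open>The difference \<open>f\<close> of the two sides vanishes at 0 and has derivative
  \<open>x\<^sup>2 / (1 - x)\<close>.\<close>

lemma chernoff_rate_lower:
  fixes \<epsilon> :: real
  assumes "0 \<le> \<epsilon>" "\<epsilon> < 1"
  shows "\<epsilon>\<^sup>2 / 2 \<le> (1 - \<epsilon>) - 1 - ln (1 - \<epsilon>)"
proof -
  define f where "f x = - x - ln (1 - x) - x\<^sup>2 / 2" for x :: real
  have "f 0 \<le> f \<epsilon>"
  proof (rule DERIV_nonneg_imp_nondecreasing[OF assms(1)])
    fix x assume x: "0 \<le> x" "x \<le> \<epsilon>"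
    have "(f has_real_derivative (- 1 + 1 / (1 - x) - x)) (at x)"
      unfolding f_def using x assms(2) by (auto intro!: derivative_eq_intros)
    moreover have "- 1 + 1 / (1 - x) - x = x\<^sup>2 / (1 - x)"
      using x assms(2) by (simp add: field_simps power2_eq_square)
    ultimately show "\<exists>y. (f has_real_derivative y) (at x) \<and> 0 \<le> y"
      using x assms(2) by (metis diff_ge_0_iff_ge divide_nonneg_nonneg less_eq_real_def order_le_less_trans zero_le_power2)
  qed
  then show ?thesis
    by (simp add: f_def)
qed

text \<open>The difference again vanishes at 0; its derivative factors as
  \<open>x * (1 / (1 - x)\<^sup>2 - 1)\<close>.\<close>

lemma chernoff_rate_upper:
  fixes \<epsilon> :: real
  assumes "0 \<le> \<epsilon>" "\<epsilon> < 1"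
  shows "\<epsilon>\<^sup>2 / 2 \<le> 1 / (1 - \<epsilon>) - 1 - ln (1 / (1 - \<epsilon>))"
proof -
  define f where "f x = 1 / (1 - x) - 1 + ln (1 - x) - x\<^sup>2 / 2" for x :: real
  have "f 0 \<le> f \<epsilon>"
  proof (rule DERIV_nonneg_imp_nondecreasing[OF assms(1)])
    fix x assume x: "0 \<le> x" "x \<le> \<epsilon>"
    have "(f has_real_derivative (1 / (1 - x)\<^sup>2 - 1 / (1 - x) - x)) (at x)"
      unfolding f_def using x assms(2)
      by (auto intro!: derivative_eq_intros simp: power2_eq_square)
    moreover have "1 / (1 - x)\<^sup>2 - 1 / (1 - x) - x = x * (1 / (1 - x)\<^sup>2 - 1)"
      using x assms(2) by (simp add: divide_simps power2_eq_square) (simp add: algebra_simps)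
    moreover have "1 \<le> 1 / (1 - x)\<^sup>2"
      using x assms(2) by (simp add: power_le_one)
    ultimately show "\<exists>y. (f has_real_derivative y) (at x) \<and> 0 \<le> y"
      using x by (metis diff_ge_0_iff_ge mult_nonneg_nonneg)
  qed
  then show ?thesis
    using assms by (simp add: f_def ln_div)
qed

subsection \<open>The entropy estimate\<close>

lemma normalized_kernel_matrix_diag_nth:
  fixes x :: "'n::finite \<Rightarrow> 'x"
  assumes "\<phi> (x i) (x i) > 0"
  shows "normalized_kernel_matrix \<phi> x $ i $ i = 1 / CARD('n)"
  using assms by (simp add: normalized_kernel_matrix_def)

text \<open>On the logarithmic scale the interval from \<open>c\<close> to \<open>1 / c\<close> is
  symmetric about 0. This is why the upper deviation is measured at
  \<open>1 / (1 - \<epsilon>)\<close>.\<close>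

lemma abs_log_le_of_reciprocal_bounds:
  fixes y b c :: real
  assumes "b > 1" "0 < c" "c < 1" "c \<le> y" "y \<le> 1 / c"
  shows "\<bar>log b y\<bar> \<le> \<bar>log b c\<bar>"
proof -
  have "log b c \<le> log b y"
    using assms by simp
  moreover have "log b y \<le> log b (1 / c)"
    using assms by (subst log_le_cancel_iff) auto
  moreover have "log b (1 / c) = - log b c"
    using assms by (simp add: log_divide)
  ultimately show ?thesis
    by linarith
qed

theorem theorem1:
  fixes X :: "'x set" and \<phi> :: "'x \<Rightarrow> 'x \<Rightarrow> real" and x :: "'n::finite \<Rightarrow> 'x"
    and G :: "real^'n^'n" and \<alpha> s :: nat and \<epsilon> \<delta> :: real
    and M :: "'w measure" and g :: "nat \<Rightarrow> 'w \<Rightarrow> real^'n"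
  assumes "infinitely_divisible_kernel X \<phi>"
    and "\<And>i. x i \<in> X"
    and "\<And>i. \<phi> (x i) (x i) > 0"
    and "G = normalized_kernel_matrix \<phi> x"
    and "\<alpha> \<ge> 2"
    and "0 < \<epsilon>" "\<epsilon> < 1" "0 < \<delta>" "\<delta> < 1"
    and "s = nat \<lceil>8 * ln (2 / \<delta>) / \<epsilon>^2\<rceil>"
    and "prob_space M"
    and "prob_space.indep_vars M (\<lambda>_. borel) g {1..s}"
    and "\<And>i. i \<in> {1..s} \<Longrightarrow> distr M borel (g i) = std_gaussian"
  shows "measure M {\<omega> \<in> space M.
           \<bar>renyi_entropy (real \<alpha>) G - renyi_entropy_estimate \<alpha> s (\<lambda>i. g i \<omega>) G\<bar>
             \<le> \<bar>1 / (1 - real \<alpha>) * log 2 (1 - \<epsilon>)\<bar>} \<ge> 1 - \<delta>"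
proof -
  interpret prob_space M by (fact assms(11))
  have kernel: "positive_kernel X \<phi>"
    using assms(1) by (simp add: infinitely_divisible_kernel_def)
  have "transpose G = G"
    unfolding assms(4) by (rule normalized_kernel_matrix_symmetric[OF kernel assms(2)])
  then obtain P d where P: "orthogonal_matrix P" and G: "G = P ** diag d ** transpose P"
    by (rule symmetric_matrix_diagonalization)
  have d_nonneg: "0 \<le> d k" for k
  proof (rule psd_diagonalized_nonneg[OF P])
    show "0 \<le> v \<bullet> ((P ** diag d ** transpose P) *v v)" for v
      using normalized_kernel_matrix_psd[OF kernel assms(2), of v] assms(4) G by simp
  qed
  define T where "T = (\<Sum>k\<in>UNIV. d k ^ \<alpha>)"
  have "T > 0"
  proof -
    obtain k where "d k \<noteq> 0"
    proof (rule ccontr)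
      assume "\<not> thesis"
      then have "\<And>k. d k = 0" using that by blast
      then have "G $ i $ i = 0" for i
        by (simp add: G matrix_matrix_mult_def[of "P ** diag d"] matrix_mul_diag_nth)
      then show False
        using normalized_kernel_matrix_diag_nth[of \<phi> x] assms(3,4) by simp
    qed
    then have "d k ^ \<alpha> > 0"
      using d_nonneg[of k] by simp
    then show ?thesis
      unfolding T_def using d_nonneg by (intro sum_pos2[of _ k]) auto
  qed
  define c where "c = 1 / (1 - real \<alpha>)"
  have entropy: "renyi_entropy (real \<alpha>) G = c * log 2 T"
    using assms(5) d_nonneg
    by (simp add: renyi_entropy_def G eigenvalues_diagonalized[OF P] T_def c_def powr_realpow'
        sum_unfold_sum_mset image_mset.compositionality comp_def)
  define w where "w k = d k ^ \<alpha> / T" for k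
  have w: "0 \<le> w k" "sum w UNIV = 1" for k
    using \<open>T > 0\<close> d_nonneg by (auto simp: w_def T_def simp flip: sum_divide_distrib)
  define Q where "Q \<omega> = (\<Sum>i=1..s. \<Sum>k\<in>UNIV. w k * (column k P \<bullet> g i \<omega>)\<^sup>2)" for \<omega>
  have estimate: "renyi_entropy_estimate \<alpha> s (\<lambda>i. g i \<omega>) G = c * log 2 (T * (Q \<omega> / s))" for \<omega>
  proof -
    have "(\<Sum>i=1..s. g i \<omega> \<bullet> (matrix_power G \<alpha> *v g i \<omega>)) = T * Q \<omega>"
      using \<open>T > 0\<close>
      by (simp add: G matrix_power_diagonalized[OF P] quadratic_form_diagonalized Q_def w_def
          sum_distrib_left)
    then show ?thesis
      by (simp add: renyi_entropy_estimate_def c_def)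
  qed
  have ln_pos: "ln (2 / \<delta>) > 0"
    using assms(8,9) by simp
  have s_ge: "8 * ln (2 / \<delta>) / \<epsilon>\<^sup>2 \<le> s"
    unfolding assms(10) by linarith
  moreover have "8 * ln (2 / \<delta>) / \<epsilon>\<^sup>2 > 0"
    using ln_pos assms(6) by simp
  ultimately have "s > 0"
    by linarith
  have [measurable]: "g i \<in> borel_measurable M" if "i \<in> {1..s}" for i
    using assms(12) that by (simp add: indep_vars_def)
  have [measurable]: "Q \<in> borel_measurable M"
    unfolding Q_def by measurable
  define D where "D r = {\<omega> \<in> space M. 0 \<le> (1 - 1 / r) * (Q \<omega> - s * r)}" for r :: real
  have [measurable]: "D r \<in> events" for r
    unfolding D_def by measurable
  have tail: "prob (D r) \<le> \<delta> / 2" if "r > 0" "\<epsilon>\<^sup>2 / 2 \<le> r - 1 - ln r" for r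
  proof -
    have "prob (D r) \<le> exp (- (s / 2) * (r - 1 - ln r))"
      using gaussian_quadratic_form_chernoff[OF finite w, of "\<lambda>k. column k P" "{1..s}" g r]
        P assms(12,13) that(1)
      by (simp add: D_def Q_def orthogonal_matrix_orthonormal_columns)
    also have "\<dots> \<le> exp (- ln (2 / \<delta>))"
    proof -
      have "ln (2 / \<delta>) \<le> (8 * ln (2 / \<delta>) / \<epsilon>\<^sup>2) / 2 * (\<epsilon>\<^sup>2 / 2)"
        using ln_pos assms(6) by simp
      also have "\<dots> \<le> s / 2 * (r - 1 - ln r)"
        using s_ge that(2) by (intro mult_mono) auto
      finally show ?thesis
        by simp
    qed
    also have "\<dots> = \<delta> / 2"
      using assms(8) by (simp add: exp_minus)
    finally show ?thesis .
  qed
  let ?E = "{\<omega> \<in> space M. \<bar>renyi_entropy (real \<alpha>) G - renyi_entropy_estimate \<alpha> s (\<lambda>i. g i \<omega>) G\<bar>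
    \<le> \<bar>1 / (1 - real \<alpha>) * log 2 (1 - \<epsilon>)\<bar>}"
  have "space M - (D (1 - \<epsilon>) \<union> D (1 / (1 - \<epsilon>))) \<subseteq> ?E"
  proof safe
    fix \<omega> assume \<omega>: "\<omega> \<in> space M" "\<omega> \<notin> D (1 - \<epsilon>)" "\<omega> \<notin> D (1 / (1 - \<epsilon>))"
    have "Q \<omega> > s * (1 - \<epsilon>)"
    proof -
      have "1 - 1 / (1 - \<epsilon>) < 0"
        using assms(6,7) by simp
      then show ?thesis
        using \<omega>(1,2) by (auto simp: D_def zero_le_mult_iff)
    qed
    moreover have "Q \<omega> < s * (1 / (1 - \<epsilon>))"
      using \<omega>(1,3) assms(6) by (auto simp: D_def zero_le_mult_iff)
    ultimately have bounds: "1 - \<epsilon> \<le> Q \<omega> / s" "Q \<omega> / s \<le> 1 / (1 - \<epsilon>)"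
      using \<open>s > 0\<close> by (auto simp: pos_le_divide_eq pos_divide_le_eq mult_ac)
    then have "log 2 (T * (Q \<omega> / s)) = log 2 T + log 2 (Q \<omega> / s)"
      using \<open>T > 0\<close> assms(7) by (intro log_mult_pos) auto
    then have "renyi_entropy (real \<alpha>) G - renyi_entropy_estimate \<alpha> s (\<lambda>i. g i \<omega>) G
        = - (c * log 2 (Q \<omega> / s))"
      by (simp add: entropy estimate algebra_simps)
    moreover have "\<bar>log 2 (Q \<omega> / s)\<bar> \<le> \<bar>log 2 (1 - \<epsilon>)\<bar>"
      using bounds assms(6,7) by (intro abs_log_le_of_reciprocal_bounds) auto
    ultimately show "\<bar>renyi_entropy (real \<alpha>) G - renyi_entropy_estimate \<alpha> s (\<lambda>i. g i \<omega>) G\<bar>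
        \<le> \<bar>1 / (1 - real \<alpha>) * log 2 (1 - \<epsilon>)\<bar>"
      by (simp add: abs_mult mult_left_mono flip: c_def)
  qed
  moreover have "?E \<in> events"
    unfolding entropy estimate by measurable
  ultimately have "prob (space M - (D (1 - \<epsilon>) \<union> D (1 / (1 - \<epsilon>)))) \<le> prob ?E"
    by (rule finite_measure_mono)
  moreover have "prob (D (1 - \<epsilon>) \<union> D (1 / (1 - \<epsilon>))) \<le> \<delta>"
  proof -
    have "prob (D (1 - \<epsilon>) \<union> D (1 / (1 - \<epsilon>))) \<le> prob (D (1 - \<epsilon>)) + prob (D (1 / (1 - \<epsilon>)))"
      by (intro measure_Un_le) auto
    also have "\<dots> \<le> \<delta> / 2 + \<delta> / 2"
      using assms(6,7) chernoff_rate_lower[of \<epsilon>] chernoff_rate_upper[of \<epsilon>]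
      by (intro add_mono tail) auto
    finally show ?thesis
      by simp
  qed
  ultimately show ?thesis
    by (simp add: prob_compl)
qed

end
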